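(* Let $X\subseteq\mathbb{N}$. A total function $v$ decides $\mathbf{M}^X$ (i.e. $v(p)=1\iff p\notin\mathbf{M}^X$) if and only if $v\geq_T X'$; and the Turing degrees of such $v$ are exactly the degrees $\geq\deg(X')$. In particular the least Turing degree of a total correct adjudicator of the $X$-standard domain is $\deg(X')$: adjudication costs exactly one jump, at every level (that is, for every oracle $X$).
   Context: $(\varphi^X_e)_{e\in\mathbb{N}}$ is the standard enumeration of the unary $X$-partial computable functions; $\mathbf{M}^X=\{p\in\mathbb{N}:\varphi^X_p(0)\!\downarrow=1\}$ (the computation on input $0$ converges with value $1$). The $X$-standard domain is the pair $(\mathbb{N},\mathbf{M}^X)$. $X'$ is the Turing jump of $X$, $\leq_T$ is Turing reducibility, and $\deg(X')$ is the Turing degree of $X'$. Total functions $v$ are from $\mathbb{N}$ to $\mathbb{N}$. A total adjudicator annuls $p$ if its value at $p$ is $1$ and exempts $p$ if its value at $p$ is different from $1$; it is correct for the $X$-standard domain if it annuls exactly the non-members of $\mathbf{M}^X$. Here adjudicators are total functions of arbitrary Turing degree, so a total correct adjudicator of the $X$-standard domain is a total function $v$ with $v(p)=1\iff p\notin\mathbf{M}^X$ for all $p$.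
   Formalization: Read literally, "if v ≥_T X' then v decides M^X" is false (v = 2 + the characteristic function of X' never takes the value 1); it is replaced by: a total w computes some v deciding M^X iff w ≥_T X'. That every deciding v satisfies v ≥_T X' is kept. *)

theory Defs
  imports Main "HOL-Library.Nat_Bijection"
begin

text \<open>
  Partial computability relative to an oracle, following Kleene's schemata.  A program has no fixed
  arity: it is run on a list of arguments, and running it on a list whose length does not fit one of
  its parts is treated as divergence.  For each arity the programs thus yield exactly the partial
  functions that are recursive in the oracle.
\<close>

datatype prog =
    Zero
  | Succ
  | Oracle
  | Proj nat nat
  | Comp prog "prog list"
  | PrimRec prog prog
  | Mu prog

text \<open>
  \<open>None\<close> stands for divergence.  Composition is strict, primitive recursion is on the first argument,
  and the search in \<open>Mu\<close> (also over the first argument) requires convergence at all values below the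
  zero that is found.
\<close>

primrec eval :: "(nat \<Rightarrow> nat) \<Rightarrow> prog \<Rightarrow> nat list \<Rightarrow> nat option" where
  "eval A Zero = (\<lambda>xs. Some 0)"
| "eval A Succ = (\<lambda>xs. if length xs = 1 then Some (Suc (hd xs)) else None)"
| "eval A Oracle = (\<lambda>xs. if length xs = 1 then Some (A (hd xs)) else None)"
| "eval A (Proj n i) = (\<lambda>xs. if length xs = n \<and> i < n then Some (xs ! i) else None)"
| "eval A (Comp f gs) = (\<lambda>xs.
     let ys = map (\<lambda>h. h xs) (map (eval A) gs)
     in if None \<in> set ys then None else eval A f (map the ys))"
| "eval A (PrimRec f g) = (\<lambda>xs. case xs of
       [] \<Rightarrow> None
     | n # ys \<Rightarrow> rec_nat (eval A f ys)
                  (\<lambda>m r. case r of None \<Rightarrow> None | Some z \<Rightarrow> eval A g (m # z # ys)) n)"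
| "eval A (Mu f) = (\<lambda>xs.
     if \<exists>n. eval A f (n # xs) = Some 0 \<and> (\<forall>m<n. eval A f (m # xs) \<noteq> None)
     then Some (LEAST n. eval A f (n # xs) = Some 0)
     else None)"

primrec goedel :: "prog \<Rightarrow> nat" where
  "goedel Zero = prod_encode (0, 0)"
| "goedel Succ = prod_encode (1, 0)"
| "goedel Oracle = prod_encode (2, 0)"
| "goedel (Proj n i) = prod_encode (3, prod_encode (n, i))"
| "goedel (Comp f gs) = prod_encode (4, prod_encode (goedel f, list_encode (map goedel gs)))"
| "goedel (PrimRec f g) = prod_encode (5, prod_encode (goedel f, goedel g))"
| "goedel (Mu f) = prod_encode (6, goedel f)"

lemma goedel_inject: "goedel p = goedel q \<Longrightarrow> p = q"
proof (induction p arbitrary: q)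
  case (Comp f gs)
  from Comp.prems obtain f' gs' where q: "q = Comp f' gs'"
    and f: "goedel f = goedel f'" and gs: "map goedel gs = map goedel gs'"
    by (cases q) (auto simp: list_encode_eq)
  have "gs = gs'"
  proof (rule nth_equalityI)
    show len: "length gs = length gs'"
      using gs by (rule map_eq_imp_length_eq)
    fix i assume i: "i < length gs"
    have "goedel (gs ! i) = goedel (gs' ! i)"
      using gs i len by (metis nth_map)
    then show "gs ! i = gs' ! i"
      by (rule Comp.IH(2)[OF nth_mem[OF i]])
  qed
  with q f Comp.IH(1) show ?case by blast
qed (case_tac q; auto)+

lemma inj_goedel: "inj goedel"
  by (rule injI) (rule goedel_inject)

text \<open>
  The enumeration of the unary partial functions computable from the oracle \<open>A\<close>; numbers that are not
  codes of programs index the nowhere defined function.  Oracles are total functions, and a set is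
  used as an oracle through its characteristic function.
\<close>

definition phi :: "(nat \<Rightarrow> nat) \<Rightarrow> nat \<Rightarrow> nat \<Rightarrow> nat option" where
  "phi A e x = (if e \<in> range goedel then eval A (inv goedel e) [x] else None)"

lemma phi_goedel [simp]: "phi A (goedel p) x = eval A p [x]"
  by (simp add: phi_def inv_f_f inj_goedel)

definition char_fun :: "nat set \<Rightarrow> nat \<Rightarrow> nat" where
  "char_fun X n = (if n \<in> X then 1 else 0)"

definition jump :: "nat set \<Rightarrow> nat set" where
  "jump X = {e. phi (char_fun X) e e \<noteq> None}"

definition turing_le :: "(nat \<Rightarrow> nat) \<Rightarrow> (nat \<Rightarrow> nat) \<Rightarrow> bool"  (infix "\<le>\<^sub>T" 50) where
  "f \<le>\<^sub>T g \<longleftrightarrow> (\<exists>e. \<forall>x. phi g e x = Some (f x))"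

definition turing_equiv :: "(nat \<Rightarrow> nat) \<Rightarrow> (nat \<Rightarrow> nat) \<Rightarrow> bool"  (infix "\<equiv>\<^sub>T" 50) where
  "f \<equiv>\<^sub>T g \<longleftrightarrow> f \<le>\<^sub>T g \<and> g \<le>\<^sub>T f"

lemma turing_le_iff_prog: "f \<le>\<^sub>T g \<longleftrightarrow> (\<exists>p. \<forall>x. eval g p [x] = Some (f x))"
proof
  assume "f \<le>\<^sub>T g"
  then obtain e where e: "\<And>x. phi g e x = Some (f x)"
    by (auto simp: turing_le_def)
  then have "e \<in> range goedel"
    by (metis option.distinct(1) phi_def)
  then obtain p where "e = goedel p"
    by blast
  with e have "eval g p [x] = Some (f x)" for x
    by (metis phi_goedel)
  then show "\<exists>p. \<forall>x. eval g p [x] = Some (f x)"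
    by blast
qed (metis phi_goedel turing_le_def)

lemma turing_le_refl: "f \<le>\<^sub>T f"
  unfolding turing_le_iff_prog by (rule exI[of _ Oracle]) simp

primrec oracle_subst :: "prog \<Rightarrow> prog \<Rightarrow> prog" where
  "oracle_subst q Zero = Zero"
| "oracle_subst q Succ = Succ"
| "oracle_subst q Oracle = Comp q [Proj 1 0]"
| "oracle_subst q (Proj n i) = Proj n i"
| "oracle_subst q (Comp f gs) = Comp (oracle_subst q f) (map (oracle_subst q) gs)"
| "oracle_subst q (PrimRec f g) = PrimRec (oracle_subst q f) (oracle_subst q g)"
| "oracle_subst q (Mu f) = Mu (oracle_subst q f)"

lemma eval_oracle_subst:
  assumes "\<And>x. eval A q [x] = Some (B x)"
  shows "eval A (oracle_subst q p) = eval B p"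
proof (induction p)
  case Oracle
  show ?case
    using assms by (auto simp: fun_eq_iff length_Suc_conv)
next
  case (Comp f gs)
  have "map (eval A) (map (oracle_subst q) gs) = map (eval B) gs"
    using Comp.IH(2) by simp
  then show ?case
    using Comp.IH(1) by (simp only: eval.simps oracle_subst.simps)
next
  case (PrimRec f g)
  show ?case
    unfolding eval.simps oracle_subst.simps PrimRec.IH ..
next
  case (Mu f)
  show ?case
    unfolding eval.simps oracle_subst.simps Mu.IH ..
qed simp_all

lemma turing_le_trans:
  assumes "f \<le>\<^sub>T g" "g \<le>\<^sub>T h"
  shows "f \<le>\<^sub>T h"
  using assms unfolding turing_le_iff_prog by (metis eval_oracle_subst)

quotient_type degree = "nat \<Rightarrow> nat" / turing_equiv
  by (rule equivpI)
    (auto intro!: reflpI sympI transpI simp: turing_equiv_def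
      intro: turing_le_refl turing_le_trans)

lift_definition deg :: "(nat \<Rightarrow> nat) \<Rightarrow> degree" is "\<lambda>f. f" .

instantiation degree :: order
begin

lift_definition less_eq_degree :: "degree \<Rightarrow> degree \<Rightarrow> bool" is turing_le
  by (auto simp: turing_equiv_def intro: turing_le_trans)

definition less_degree :: "degree \<Rightarrow> degree \<Rightarrow> bool" where
  "less_degree a b \<longleftrightarrow> a \<le> b \<and> \<not> b \<le> a"

instance
proof
  fix x y z :: degree
  show "x < y \<longleftrightarrow> x \<le> y \<and> \<not> y \<le> x" by (rule less_degree_def)
  show "x \<le> x" by transfer (rule turing_le_refl)
  show "x \<le> y \<Longrightarrow> y \<le> z \<Longrightarrow> x \<le> z" by transfer (rule turing_le_trans)
  show "x \<le> y \<Longrightarrow> y \<le> x \<Longrightarrow> x = y" by transfer (simp add: turing_equiv_def)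
qed

end

lemma deg_le_iff: "deg f \<le> deg g \<longleftrightarrow> f \<le>\<^sub>T g"
  by transfer (rule refl)

lemma deg_eq_iff: "deg f = deg g \<longleftrightarrow> f \<equiv>\<^sub>T g"
  by transfer (rule refl)

definition members :: "nat set \<Rightarrow> nat set" where
  "members X = {p. phi (char_fun X) p 0 = Some 1}"

text \<open>A domain is a pair of a universe and the set of its members.\<close>

definition standard_domain :: "nat set \<Rightarrow> nat set \<times> nat set" where
  "standard_domain X = (UNIV, members X)"

definition annuls :: "(nat \<Rightarrow> nat) \<Rightarrow> nat \<Rightarrow> bool" where
  "annuls v p \<longleftrightarrow> v p = 1"

definition correct_adjudicator :: "nat set \<times> nat set \<Rightarrow> (nat \<Rightarrow> nat) \<Rightarrow> bool" where
  "correct_adjudicator D v \<longleftrightarrow> (\<forall>p \<in> fst D. annuls v p \<longleftrightarrow> p \<notin> snd D)"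

definition decides :: "(nat \<Rightarrow> nat) \<Rightarrow> nat set \<Rightarrow> bool" where
  "decides v M \<longleftrightarrow> (\<forall>p. v p = 1 \<longleftrightarrow> p \<notin> M)"

end

theory Submission imports Defs begin

text \<open>
  The set \<open>members X\<close> and the jump of \<open>X\<close> are many-one reducible to each other by computable
  transformations of programs, so every decider computes the jump and the jump computes a decider.
  A decider only has to avoid the value 1 on \<open>members X\<close>; since a computable increasing sequence of
  codes lies in \<open>members X\<close>, any function above the jump can be stored in these free values, which
  realises every degree above the jump.
\<close>

section \<open>Total functions recursive in an oracle\<close>

text \<open>Programs carry no arity, so the length \<open>n\<close> is fixed here and nothing is
  asked of other lists. Taking the whole argument list lets the closure rules below follow the
  syntax of a term.\<close>

definition recursive_in :: "(nat \<Rightarrow> nat) \<Rightarrow> nat \<Rightarrow> (nat list \<Rightarrow> nat) \<Rightarrow> bool" where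
  "recursive_in A n F \<longleftrightarrow> (\<exists>p. \<forall>xs. length xs = n \<longrightarrow> eval A p xs = Some (F xs))"

lemma recursive_inI:
  "(\<And>xs. length xs = n \<Longrightarrow> eval A p xs = Some (F xs)) \<Longrightarrow> recursive_in A n F"
  by (auto simp: recursive_in_def)

lemma recursive_in_cong:
  assumes "recursive_in A n F" "\<And>xs. length xs = n \<Longrightarrow> F xs = G xs"
  shows "recursive_in A n G"
  using assms by (auto simp: recursive_in_def)

lemma turing_le_iff_recursive_in: "f \<le>\<^sub>T A \<longleftrightarrow> recursive_in A 1 (\<lambda>xs. f (xs ! 0))"
  unfolding turing_le_iff_prog recursive_in_def
  by (intro ex_cong1) (auto simp: length_Suc_conv)

lemma recursive_in_nth: "i < n \<Longrightarrow> recursive_in A n (\<lambda>xs. xs ! i)"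
  by (rule recursive_inI[of _ _ "Proj n i"]) simp

lemma recursive_in_comp:
  assumes F: "recursive_in A (length Gs) F" and Gs: "\<And>G. G \<in> set Gs \<Longrightarrow> recursive_in A n G"
  shows "recursive_in A n (\<lambda>xs. F (map (\<lambda>G. G xs) Gs))"
proof -
  obtain p where p: "\<And>xs. length xs = length Gs \<Longrightarrow> eval A p xs = Some (F xs)"
    using F by (auto simp: recursive_in_def)
  obtain q where q: "\<And>G xs. G \<in> set Gs \<Longrightarrow> length xs = n \<Longrightarrow> eval A (q G) xs = Some (G xs)"
    using Gs unfolding recursive_in_def by metis
  show ?thesis
  proof (rule recursive_inI)
    fix xs :: "nat list" assume xs: "length xs = n"
    have "map (\<lambda>h. h xs) (map (eval A) (map q Gs)) = map Some (map (\<lambda>G. G xs) Gs)"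
      using q xs by simp
    then show "eval A (Comp p (map q Gs)) xs = Some (F (map (\<lambda>G. G xs) Gs))"
      by (simp only: eval.simps Let_def) (auto simp: p comp_def)
  qed
qed

lemma recursive_in_comp1:
  assumes "recursive_in A 1 (\<lambda>xs. f (xs ! 0))" "recursive_in A n G"
  shows "recursive_in A n (\<lambda>xs. f (G xs))"
  using recursive_in_comp[of A "[G]" "\<lambda>xs. f (xs ! 0)" n] assms by simp

text \<open>With \<open>turing_le_refl\<close> this becomes the rule for querying the oracle
  \<open>A\<close> itself.\<close>

lemma recursive_in_turing_le:
  assumes "f \<le>\<^sub>T A" "recursive_in A n G"
  shows "recursive_in A n (\<lambda>xs. f (G xs))"
  using assms by (simp only: turing_le_iff_recursive_in) (rule recursive_in_comp1)

lemma recursive_in_Suc: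
  assumes "recursive_in A n F"
  shows "recursive_in A n (\<lambda>xs. Suc (F xs))"
  using assms by (rule recursive_in_comp1[rotated])
    (rule recursive_inI[of _ _ Succ], auto simp: length_Suc_conv)

lemma recursive_in_const: "recursive_in A n (\<lambda>xs. c)"
proof (induction c)
  case 0
  show ?case by (rule recursive_inI[of _ _ Zero]) simp
next
  case (Suc c)
  then show ?case by (rule recursive_in_Suc)
qed

lemma recursive_in_drop:
  assumes "recursive_in A n F"
  shows "recursive_in A (k + n) (\<lambda>xs. F (drop k xs))"
proof -
  have "recursive_in A (k + n) (\<lambda>xs. F (map (\<lambda>G. G xs) (map (\<lambda>i xs. xs ! (k + i)) [0..<n])))"
    using assms by (intro recursive_in_comp) (auto intro: recursive_in_nth)
  then show ?thesis
    by (rule recursive_in_cong) (auto intro!: arg_cong[of _ _ F] nth_equalityI)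
qed

text \<open>\<open>PrimRec\<close> takes its counter as the first argument. The recursion is
  therefore built with a separate counter in front of the parameters, and then composed with
  \<open>T\<close> and the projections.\<close>

lemma recursive_in_rec_nat:
  assumes F: "recursive_in A n F" and T: "recursive_in A n T"
    and G: "recursive_in A (Suc (Suc n)) (\<lambda>ys. G (ys ! 0) (ys ! 1) (drop 2 ys))"
  shows "recursive_in A n (\<lambda>xs. rec_nat (F xs) (\<lambda>m r. G m r xs) (T xs))"
proof -
  obtain p where p: "\<And>xs. length xs = n \<Longrightarrow> eval A p xs = Some (F xs)"
    using F by (auto simp: recursive_in_def)
  obtain q where q: "\<And>m r xs. length xs = n \<Longrightarrow> eval A q (m # r # xs) = Some (G m r xs)"
  proof -
    obtain q where "\<And>ys. length ys = Suc (Suc n) \<Longrightarrow>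
        eval A q ys = Some (G (ys ! 0) (ys ! 1) (drop 2 ys))"
      using G by (auto simp: recursive_in_def)
    from this[of "_ # _ # _"] show ?thesis
      by (intro that[of q]) simp
  qed
  have step: "recursive_in A (Suc n)
    (\<lambda>ys. rec_nat (F (tl ys)) (\<lambda>m r. G m r (tl ys)) (hd ys))"
  proof (rule recursive_inI)
    fix ys :: "nat list" assume "length ys = Suc n"
    then obtain t xs where ys: "ys = t # xs" and xs: "length xs = n"
      by (auto simp: length_Suc_conv)
    show "eval A (PrimRec p q) ys = Some (rec_nat (F (tl ys)) (\<lambda>m r. G m r (tl ys)) (hd ys))"
      unfolding ys by (induction t) (simp_all add: p q xs)
  qed
  have nths: "map ((!) xs) [0..<n] = xs" if "length xs = n" for xs :: "nat list"
    using map_nth[of xs] that by simp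
  have "recursive_in A n (\<lambda>xs. (\<lambda>ys. rec_nat (F (tl ys)) (\<lambda>m r. G m r (tl ys)) (hd ys))
      (map (\<lambda>G. G xs) (T # map (\<lambda>i xs. xs ! i) [0..<n])))"
    using step T by (intro recursive_in_comp) (auto intro: recursive_in_nth)
  then show ?thesis
    by (rule recursive_in_cong) (simp add: comp_def nths)
qed

text \<open>Since \<open>F\<close> is total, the convergence condition in \<open>Mu\<close> holds
  automatically, and \<open>ex\<close> ensures that the search stops.\<close>

lemma recursive_in_Least:
  assumes F: "recursive_in A (Suc n) (\<lambda>ys. F (ys ! 0) (drop 1 ys))"
    and ex: "\<And>xs. length xs = n \<Longrightarrow> \<exists>m. F m xs = 0"
  shows "recursive_in A n (\<lambda>xs. LEAST m. F m xs = 0)"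
proof -
  obtain p where p: "\<And>m xs. length xs = n \<Longrightarrow> eval A p (m # xs) = Some (F m xs)"
  proof -
    obtain p where "\<And>ys. length ys = Suc n \<Longrightarrow> eval A p ys = Some (F (ys ! 0) (drop 1 ys))"
      using F by (auto simp: recursive_in_def)
    from this[of "_ # _"] show ?thesis
      by (intro that[of p]) simp
  qed
  show ?thesis
    by (rule recursive_inI[of _ _ "Mu p"]) (simp add: p ex)
qed

section \<open>Case distinction, arithmetic and pairing\<close>

lemma recursive_in_if_zero:
  assumes "recursive_in A n C" "recursive_in A n F" "recursive_in A n G"
  shows "recursive_in A n (\<lambda>xs. if C xs = 0 then F xs else G xs)"
proof -
  \<comment> \<open>The step ignores the counter and the previous value, so any positive count
    yields \<open>G xs\<close>; \<open>recursive_in_drop\<close> skips these two arguments.\<close>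
  have "recursive_in A n (\<lambda>xs. rec_nat (F xs) (\<lambda>m r. G xs) (C xs))"
    using recursive_in_drop[OF assms(3), of 2] assms by (intro recursive_in_rec_nat) simp_all
  then show ?thesis
    by (rule recursive_in_cong) (auto split: nat.split simp: gr0_conv_Suc)
qed

lemma recursive_in_add:
  assumes "recursive_in A n F" "recursive_in A n G"
  shows "recursive_in A n (\<lambda>xs. F xs + G xs)"
proof -
  have "recursive_in A n (\<lambda>xs. rec_nat (F xs) (\<lambda>m r. Suc r) (G xs))"
    using assms by (intro recursive_in_rec_nat recursive_in_Suc recursive_in_nth) simp_all
  moreover have "rec_nat a (\<lambda>m r. Suc r) b = a + b" for a b :: nat
    by (induction b) auto
  ultimately show ?thesis by simp
qed

lemma recursive_in_pred:
  assumes "recursive_in A n F"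
  shows "recursive_in A n (\<lambda>xs. F xs - 1)"
proof -
  have "recursive_in A n (\<lambda>xs. rec_nat 0 (\<lambda>m r. m) (F xs))"
    using assms by (intro recursive_in_rec_nat recursive_in_const recursive_in_nth) simp_all
  moreover have "rec_nat 0 (\<lambda>m r. m) a = a - 1" for a :: nat
    by (cases a) auto
  ultimately show ?thesis by simp
qed

lemma recursive_in_diff:
  assumes "recursive_in A n F" "recursive_in A n G"
  shows "recursive_in A n (\<lambda>xs. F xs - G xs)"
proof -
  have "recursive_in A n (\<lambda>xs. rec_nat (F xs) (\<lambda>m r. r - 1) (G xs))"
    using assms by (intro recursive_in_rec_nat recursive_in_pred recursive_in_nth) simp_all
  moreover have "rec_nat a (\<lambda>m r. r - 1) b = a - b" for a b :: nat
    by (induction b) auto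
  ultimately show ?thesis by simp
qed

lemma recursive_in_prod_encode:
  assumes "recursive_in A n F" "recursive_in A n G"
  shows "recursive_in A n (\<lambda>xs. prod_encode (F xs, G xs))"
proof -
  have "recursive_in A n (\<lambda>xs. rec_nat 0 (\<lambda>m r. r + Suc m) (F xs + G xs))"
    using assms by (intro recursive_in_rec_nat recursive_in_const recursive_in_add
        recursive_in_Suc recursive_in_nth) simp_all
  moreover have "rec_nat 0 (\<lambda>m r. r + Suc m) a = triangle a" for a
    by (induction a) auto
  ultimately have "recursive_in A n (\<lambda>xs. triangle (F xs + G xs))" by simp
  then show ?thesis
    unfolding prod_encode_def prod.case using assms(1) by (rule recursive_in_add)
qed

lemmas recursive_in_intros =
  recursive_in_const recursive_in_Suc recursive_in_if_zero recursive_in_diff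
  recursive_in_prod_encode

section \<open>Reductions between the members and the jump\<close>

text \<open>\<open>Suc (prod_encode (b, 0))\<close> is \<open>list_encode [b]\<close>, so the number
  has the shape of a unary composition. Code transformations built from it thus send non-codes to
  non-codes.\<close>

lemma goedel_Comp_in_range:
  assumes "prod_encode (4, prod_encode (a, Suc (prod_encode (b, 0)))) \<in> range goedel"
  shows "a \<in> range goedel \<and> b \<in> range goedel"
proof -
  obtain r where r: "goedel r = prod_encode (4, prod_encode (a, Suc (prod_encode (b, 0))))"
    using assms by auto
  then obtain f gs where "r = Comp f gs"
    by (cases r) auto
  with r have a: "goedel f = a" and b: "list_encode (map goedel gs) = list_encode [b]"
    by auto
  from b have "map goedel gs = [b]"
    by (simp only: list_encode_eq)
  with a show ?thesis by auto
qed

primrec numeral_prog :: "nat \<Rightarrow> prog" where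
  "numeral_prog 0 = Zero"
| "numeral_prog (Suc n) = Comp Succ [numeral_prog n]"

lemma eval_numeral_prog [simp]: "eval A (numeral_prog n) xs = Some n"
  by (induction n arbitrary: xs) auto

lemma recursive_in_goedel_numeral_prog:
  assumes "recursive_in A n F"
  shows "recursive_in A n (\<lambda>xs. goedel (numeral_prog (F xs)))"
proof -
  have "recursive_in A n (\<lambda>xs. rec_nat 0 (\<lambda>m r. prod_encode (4, prod_encode (goedel Succ,
      Suc (prod_encode (r, 0))))) (F xs))"
    using assms by (intro recursive_in_rec_nat recursive_in_intros recursive_in_nth) simp_all
  moreover have "rec_nat 0 (\<lambda>m r. prod_encode (4, prod_encode (goedel Succ,
      Suc (prod_encode (r, 0))))) a = goedel (numeral_prog a)" for a
    \<comment> \<open>The base value 0 is \<open>goedel Zero\<close>, because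
      \<open>prod_encode (0, 0) = 0\<close>.\<close>
    by (induction a) (auto simp: prod_encode_def)
  ultimately show ?thesis by simp
qed

text \<open>For \<open>e = goedel p\<close> this codes the program that ignores its input, runs
  \<open>p\<close> on \<open>e\<close> and then returns 1; strict composition passes on divergence.
  The arithmetic form also covers non-codes and is visibly computable.\<close>

definition halting_code :: "nat \<Rightarrow> nat" where
  "halting_code e = prod_encode (4, prod_encode (goedel (numeral_prog 1), Suc (prod_encode
     (prod_encode (4, prod_encode (e, Suc (prod_encode (goedel (numeral_prog e), 0)))), 0))))"

lemma halting_code_in_members_iff: "halting_code e \<in> members X \<longleftrightarrow> e \<in> jump X"
proof (cases "e \<in> range goedel")
  case True
  then obtain p where e: "e = goedel p" by auto
  then have "halting_code e = goedel (Comp (numeral_prog 1) [Comp p [numeral_prog e]])"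
    by (simp add: halting_code_def)
  then have "phi A (halting_code e) 0 = (if eval A p [e] = None then None else Some 1)" for A
    by (simp del: goedel.simps numeral_prog.simps)
  then show ?thesis
    by (simp add: members_def jump_def e)
next
  case False
  then have "halting_code e \<notin> range goedel"
    unfolding halting_code_def using goedel_Comp_in_range by blast
  with False show ?thesis
    by (simp add: members_def jump_def phi_def)
qed

text \<open>The nested recursions take the value 0 at 1 and the value 1 elsewhere.
  \<open>Proj 2 1\<close> discards the search variable, so the search either stops at once or
  never.\<close>

definition acceptor :: prog where
  "acceptor = Mu (Comp (PrimRec (numeral_prog 1) (PrimRec Zero (numeral_prog 1))) [Proj 2 1])"

lemma eval_acceptor: "eval A acceptor [x] \<noteq> None \<longleftrightarrow> x = 1"
proof -
  have "eval A (PrimRec Zero (numeral_prog 1)) [m, z] = Some (if m = 0 then 0 else 1)" for m z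
    by (induction m) (auto simp del: numeral_prog.simps)
  then have "eval A (PrimRec (numeral_prog 1) (PrimRec Zero (numeral_prog 1))) [x]
      = Some (if x = 1 then 0 else 1)" for x
    by (induction x) (auto simp del: numeral_prog.simps)
  then show ?thesis
    unfolding acceptor_def by (simp del: numeral_prog.simps eval.simps(6))
qed

text \<open>For \<open>e = goedel p\<close> the coded program runs \<open>p\<close> on 0 and hands
  the result to \<open>acceptor\<close>. Its own input is ignored, so the diagonal argument in
  \<open>jump\<close> does no harm.\<close>

definition acceptance_code :: "nat \<Rightarrow> nat" where
  "acceptance_code e = prod_encode (4, prod_encode (goedel acceptor, Suc (prod_encode
     (prod_encode (4, prod_encode (e, Suc (prod_encode (goedel Zero, 0)))), 0))))"

lemma acceptance_code_in_jump_iff: "acceptance_code e \<in> jump X \<longleftrightarrow> e \<in> members X"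
proof (cases "e \<in> range goedel")
  case True
  then obtain p where e: "e = goedel p" by auto
  then have "acceptance_code e = goedel (Comp acceptor [Comp p [Zero]])"
    by (simp add: acceptance_code_def)
  then have "phi A (acceptance_code e) y \<noteq> None \<longleftrightarrow> eval A p [0] = Some 1" for A y
    using eval_acceptor[of A] by (cases "eval A p [0]") (simp_all del: goedel.simps)
  then show ?thesis
    by (simp add: members_def jump_def e)
next
  case False
  then have "acceptance_code e \<notin> range goedel"
    unfolding acceptance_code_def using goedel_Comp_in_range by blast
  with False show ?thesis
    by (simp add: members_def jump_def phi_def)
qed

section \<open>Turing reductions from the code transformations\<close>

lemma recursive_in_halting_code: "recursive_in A 1 (\<lambda>xs. halting_code (xs ! 0))"
  unfolding halting_code_def
  by (intro recursive_in_intros recursive_in_goedel_numeral_prog recursive_in_nth) simp_all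

lemma recursive_in_acceptance_code: "recursive_in A 1 (\<lambda>xs. acceptance_code (xs ! 0))"
  unfolding acceptance_code_def by (intro recursive_in_intros recursive_in_nth) simp_all

lemma jump_turing_le_decider:
  assumes "decides v (members X)"
  shows "char_fun (jump X) \<le>\<^sub>T v"
proof -
  have "v (halting_code e) = 1 \<longleftrightarrow> e \<notin> jump X" for e
    using assms by (simp only: decides_def halting_code_in_members_iff)
  \<comment> \<open>Truncated subtraction turns the test for the value 1 into the zero test that
    \<open>recursive_in_if_zero\<close> handles.\<close>
  moreover have "x - 1 + (1 - x) = 0 \<longleftrightarrow> x = 1" for x :: nat
    by arith
  ultimately have "char_fun (jump X) e = (if (v (halting_code e) - 1) + (1 - v (halting_code e)) = 0
      then 0 else 1)" for e
    by (simp only: char_fun_def) simp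
  then show ?thesis
    by (simp only: turing_le_iff_recursive_in)
      (intro recursive_in_intros recursive_in_add recursive_in_turing_le[OF turing_le_refl]
        recursive_in_halting_code)
qed

lemma char_fun_members_turing_le_jump: "char_fun (members X) \<le>\<^sub>T char_fun (jump X)"
proof -
  have "char_fun (members X) e = char_fun (jump X) (acceptance_code e)" for e
    by (simp add: char_fun_def acceptance_code_in_jump_iff)
  then show ?thesis
    by (simp only: turing_le_iff_recursive_in)
      (rule recursive_in_turing_le[OF turing_le_refl recursive_in_acceptance_code])
qed

section \<open>Realising the degrees above the jump\<close>

text \<open>The number \<open>n\<close> enters only as the arity of a projection, which makes the
  code computable and strictly increasing in \<open>n\<close>.\<close>

definition pad_code :: "nat \<Rightarrow> nat" where
  "pad_code n = goedel (PrimRec (numeral_prog 1) (Proj n 0))"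

text \<open>Run on input 0, the recursion returns its base value and never consults the padding.\<close>

lemma pad_code_in_members: "pad_code n \<in> members X"
  unfolding members_def pad_code_def
  by (simp del: goedel.simps numeral_prog.simps)

lemma triangle_strict_mono: "strict_mono triangle"
  by (simp add: strict_mono_Suc_iff)

lemma prod_encode_strict_mono_snd: "b < c \<Longrightarrow> prod_encode (a, b) < prod_encode (a, c)"
  using strict_monoD[OF triangle_strict_mono] by (simp add: prod_encode_def)

lemma prod_encode_strict_mono_fst: "b < c \<Longrightarrow> prod_encode (b, a) < prod_encode (c, a)"
  using strict_monoD[OF triangle_strict_mono] by (simp add: prod_encode_def add_strict_mono)

lemma strict_mono_pad_code: "strict_mono pad_code"
  by (auto intro!: strict_monoI prod_encode_strict_mono_snd prod_encode_strict_mono_fst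
      simp: pad_code_def)

lemma recursive_in_pad_code:
  assumes "recursive_in A n F"
  shows "recursive_in A n (\<lambda>xs. pad_code (F xs))"
  unfolding pad_code_def goedel.simps using assms by (intro recursive_in_intros)

text \<open>The search asks for \<open>p \<le> pad_code n\<close> instead of equality: a strictly
  increasing sequence satisfies this at \<open>n = p\<close>, so this left inverse of
  \<open>pad_code\<close> is total.\<close>

definition unpad :: "nat \<Rightarrow> nat" where
  "unpad p = (LEAST n. p - pad_code n = 0)"

lemma unpad_pad_code: "unpad (pad_code n) = n"
  unfolding unpad_def
  by (rule Least_equality) (auto simp: strict_mono_less_eq[OF strict_mono_pad_code])

lemma unpad_turing_le: "unpad \<le>\<^sub>T A"
  unfolding turing_le_iff_recursive_in unpad_def
proof (rule recursive_in_Least)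
  show "recursive_in A (Suc 1) (\<lambda>ys. drop 1 ys ! 0 - pad_code (ys ! 0))"
    by (rule recursive_in_cong[of _ _ "\<lambda>ys. ys ! 1 - pad_code (ys ! 0)"])
      (auto intro!: recursive_in_diff recursive_in_pad_code recursive_in_nth)
  show "\<exists>m. xs ! 0 - pad_code m = 0" for xs
    using strict_mono_imp_increasing[OF strict_mono_pad_code] by auto
qed

lemma decider_of_degree:
  assumes "char_fun (jump X) \<le>\<^sub>T w"
  obtains v where "decides v (members X)" "v \<equiv>\<^sub>T w"
proof
  \<comment> \<open>Members receive a value of \<open>w\<close> shifted by two, which keeps it away
    from 1; at \<open>pad_code n\<close> the stored value is \<open>w n\<close>.\<close>
  define v where "v p = (if char_fun (members X) p = 0 then 1 else Suc (Suc (w (unpad p))))" for p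
  show "decides v (members X)"
    by (simp add: decides_def v_def char_fun_def)
  have M: "char_fun (members X) \<le>\<^sub>T w"
    using char_fun_members_turing_le_jump assms by (rule turing_le_trans)
  have "v \<le>\<^sub>T w"
    unfolding turing_le_iff_recursive_in v_def
    by (intro recursive_in_intros recursive_in_turing_le[OF M]
        recursive_in_turing_le[OF turing_le_refl] recursive_in_turing_le[OF unpad_turing_le]
        recursive_in_nth) simp_all
  moreover have "w n = v (pad_code n) - 2" for n
    by (simp add: v_def char_fun_def pad_code_in_members unpad_pad_code)
  then have "w \<le>\<^sub>T v"
    by (simp only: turing_le_iff_recursive_in)
      (intro recursive_in_intros recursive_in_turing_le[OF turing_le_refl]
        recursive_in_pad_code recursive_in_nth, simp)
  ultimately show "v \<equiv>\<^sub>T w"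
    by (simp add: turing_equiv_def)
qed

section \<open>Adjudicators and the degree spectrum of deciders\<close>

lemma correct_adjudicator_standard_domain_iff:
  "correct_adjudicator (standard_domain X) v \<longleftrightarrow> decides v (members X)"
  by (simp add: correct_adjudicator_def standard_domain_def annuls_def decides_def)

text \<open>The equivalence speaks of computing some decider, because a function above the jump need
  not decide anything itself: it may never take the value 1, although non-members exist.\<close>

theorem theorem6p1:
  fixes X :: "nat set"
  shows "(\<forall>v. decides v (members X) \<longrightarrow> char_fun (jump X) \<le>\<^sub>T v)
    \<and> (\<forall>w. (\<exists>v. v \<le>\<^sub>T w \<and> decides v (members X)) \<longleftrightarrow> char_fun (jump X) \<le>\<^sub>T w)
    \<and> {deg v | v. decides v (members X)} = {d. deg (char_fun (jump X)) \<le> d}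
    \<and> (\<exists>v. correct_adjudicator (standard_domain X) v \<and> deg v = deg (char_fun (jump X)))
    \<and> (\<forall>v. correct_adjudicator (standard_domain X) v \<longrightarrow> deg (char_fun (jump X)) \<le> deg v)"
proof (intro conjI allI impI iffI)
  fix w assume "\<exists>v. v \<le>\<^sub>T w \<and> decides v (members X)"
  then show "char_fun (jump X) \<le>\<^sub>T w"
    using jump_turing_le_decider turing_le_trans by blast
next
  fix w assume "char_fun (jump X) \<le>\<^sub>T w"
  then show "\<exists>v. v \<le>\<^sub>T w \<and> decides v (members X)"
    using decider_of_degree unfolding turing_equiv_def by metis
next
  have "d \<in> {deg v | v. decides v (members X)}" if "deg (char_fun (jump X)) \<le> d" for d
  proof -
    \<comment> \<open>Every degree is the degree of a representative function.\<close>
    obtain w where d: "d = deg w"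
      by transfer (auto simp: turing_equiv_def intro: turing_le_refl)
    with that obtain v where "decides v (members X)" "v \<equiv>\<^sub>T w"
      using decider_of_degree by (auto simp: deg_le_iff)
    with d show ?thesis
      unfolding deg_eq_iff[symmetric] by (auto intro: exI[of _ v])
  qed
  then show "{deg v | v. decides v (members X)} = {d. deg (char_fun (jump X)) \<le> d}"
    using jump_turing_le_decider by (auto simp: deg_le_iff)
next
  \<comment> \<open>The jump itself serves as the degree to be realised.\<close>
  show "\<exists>v. correct_adjudicator (standard_domain X) v \<and> deg v = deg (char_fun (jump X))"
    using decider_of_degree[OF turing_le_refl]
    by (metis correct_adjudicator_standard_domain_iff deg_eq_iff)
qed (simp_all add: correct_adjudicator_standard_domain_iff deg_le_iff jump_turing_le_decider)

end
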